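(* Let $1\le M\le N$ and $D\ge 1$ be integers, let $\tau>0$, $\beta>0$, $p\in\mathbb{R}$, and let $\mathbf{L}=\mathbf{D}^{-p}(\mathbf{D}-\mathbf{W})\mathbf{D}^{-p}\in\mathbb{R}^{N\times N}$ be the symmetrically normalized graph Laplacian of a weighted graph with adjacency matrix $\mathbf{W}$ and degree matrix $\mathbf{D}$ having positive diagonal entries. For $\mathbf{\Theta}\in\mathbb{R}^{N\times D}$ put $$\mathcal{R}(\mathbf{\Theta}) := \langle \mathbf{\Theta}, (\mathbf{L}+\tau \mathbf{I}_N)^\beta\mathbf{\Theta}\rangle_F .$$ Let $\mathbf{\Phi}\in\mathbb{R}^{N\times D}$ be the matrix of true displacements, i.e. $\Phi_{ij}=u^{(i)}_j-\bar u^{(i)}_j$ for $i\in\{1,\dots,N\}$, $j\in\{1,\dots,D\}$, where $\mathbf{u}^{(i)}\in\mathbb{R}^D$ are the true data and $\bar{\mathbf{u}}^{(i)}\in\mathbb{R}^D$ the low-fidelity data. For each $n\in\mathbb{N}$ let $\hat{\mathbf{u}}^{(1)}_n,\dots,\hat{\mathbf{u}}^{(M)}_n\in\mathbb{R}^D$ be the $n$-th realization of the high-fidelity data, and let $\hat{\mathbf{\Phi}}_n\in\mathbb{R}^{M\times D}$ have entries $[\hat{\mathbf{\Phi}}_n]_{ij}=(\hat{\mathbf{u}}^{(i)}_n)_j-\bar u^{(i)}_j$. Let $\omega_n>0$ for $n\in\mathbb{N}$, set $\delta_n:=\|\hat{\mathbf{\Phi}}_n-\mathbf{P}_M\mathbf{\Phi}\|_F$,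 and let $$\mathbf{\Phi}_n^*\in\operatorname*{argmin}_{\mathbf{\Theta}\in\mathbb{R}^{N\times D}}\ \frac12\|\mathbf{P}_M\mathbf{\Theta}-\hat{\mathbf{\Phi}}_n\|_F^2+\omega_n\mathcal{R}(\mathbf{\Theta}).$$ Suppose that as $n\to\infty$: (i) $\delta_n\downarrow 0$; (ii) $\omega_n\downarrow 0$; (iii) $\delta_n^2/\omega_n\to 0$. Then $\mathbf{\Phi}_n^*\to\mathbf{\Phi}_\infty^*$ as $n\to\infty$, where $\mathbf{\Phi}_\infty^*$ is the unique solution of $$\operatorname*{argmin}_{\mathbf{\Theta}\in\mathbb{R}^{N\times D}}\ \mathcal{R}(\mathbf{\Theta})\quad\text{subject to}\quad \mathbf{P}_M\mathbf{\Theta}=\mathbf{P}_M\mathbf{\Phi}$$ (in particular, this constrained problem has exactly one solution).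
   Context: Graph Laplacian: $\mathbf{W}=[W_{ij}]\in\mathbb{R}^{N\times N}$ is a weight (adjacency) matrix with $W_{ij}=W_{ji}$, $W_{ij}\ge 0$ and $W_{ii}=0$ for all $i,j$. The degree matrix $\mathbf{D}$ (boldface, not to be confused with the data dimension $D$) is the $N\times N$ diagonal matrix with $D_{ii}=\sum_{j=1}^N W_{ij}$. The matrix $\mathbf{L}$ is symmetric positive semi-definite, and $(\mathbf{L}+\tau\mathbf{I}_N)^\beta$ is the real power of the symmetric positive definite matrix $\mathbf{L}+\tau\mathbf{I}_N$ defined by its spectral decomposition. Notation: $\mathbf{I}_N$ is the $N\times N$ identity matrix. $\langle \mathbf{A},\mathbf{B}\rangle_F=\operatorname{tr}(\mathbf{A}^T\mathbf{B})$ is the Frobenius inner product and $\|\cdot\|_F$ the Frobenius norm. $\mathbf{P}_M=(\mathbf{I}_M\ \ \mathbf{0}_{M\times(N-M)})\in\mathbb{R}^{M\times N}$ is the matrix extracting the first $M$ rows. The notation $x_n\downarrow 0$ means that the sequence $x_n$ decreases to $0$ (monotonically, not necessarily strictly). *)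

theory Defs
  imports Complex_Main "Jordan_Normal_Form.Matrix"
begin

text \<open>
  Vectors and matrices are those of \<^theory>\<open>Jordan_Normal_Form.Matrix\<close>, so that the dimensions
  \<open>N\<close>, \<open>M\<close>, \<open>D\<close> are ordinary natural numbers; indices start at \<open>0\<close>.
\<close>

definition mat_trace :: "real mat \<Rightarrow> real" where
  "mat_trace A = (\<Sum>i<dim_row A. A $$ (i, i))"

definition frob_inner :: "real mat \<Rightarrow> real mat \<Rightarrow> real" where
  "frob_inner A B = mat_trace (transpose_mat A * B)"

definition frob_norm :: "real mat \<Rightarrow> real" where
  "frob_norm A = sqrt (frob_inner A A)"

text \<open>
  Real power of a symmetric positive definite matrix. The first conjunct says that
  \<open>U\<close> is orthogonal and \<open>A = U diag(d) U\<^sup>T\<close>. By lemma \<open>mat_powr_eqI\<close> the result does not depend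
  on the chosen decomposition; it is meaningful only if all eigenvalues \<open>d i\<close> are positive.
\<close>

definition mat_powr :: "real mat \<Rightarrow> real \<Rightarrow> real mat" where
  "mat_powr A b = (THE B. \<exists>U d.
     similar_mat_wit A (mat_diag (dim_row A) d) U (transpose_mat U) \<and>
     B = U * mat_diag (dim_row A) (\<lambda>i. d i powr b) * transpose_mat U)"

lemma spectral_powr_unique:
  fixes A :: "real mat"
  assumes "similar_mat_wit A (mat_diag n d) U (transpose_mat U)"
    and "similar_mat_wit A (mat_diag n e) V (transpose_mat V)"
    and n: "n = dim_row A"
  shows "U * mat_diag n (\<lambda>i. d i powr b) * transpose_mat U
       = V * mat_diag n (\<lambda>i. e i powr b) * transpose_mat V"
proof -
  note u = similar_mat_witD[OF n assms(1)] and v = similar_mat_witD[OF n assms(2)]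
  define Q where "Q = transpose_mat V * U"
  have Q: "Q \<in> carrier_mat n n" using u v by (auto simp: Q_def)
  have VQ: "V * Q = U"
  proof -
    have "V * Q = (V * transpose_mat V) * U"
      unfolding Q_def by (rule assoc_mult_mat[symmetric, of _ n n _ n _ n]) (use u v in auto)
    then show ?thesis using u v by simp
  qed
  have QU: "Q * transpose_mat U = transpose_mat V"
  proof -
    have "Q * transpose_mat U = transpose_mat V * (U * transpose_mat U)"
      unfolding Q_def by (rule assoc_mult_mat[of _ n n _ n _ n]) (use u v in auto)
    then show ?thesis using u v by simp
  qed
  have conj: "transpose_mat V * (X * Y * transpose_mat X) * U = (transpose_mat V * X) * Y * (transpose_mat X * U)"
    if "X \<in> carrier_mat n n" "Y \<in> carrier_mat n n" for X Y :: "real mat"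
  proof -
    have c: "U \<in> carrier_mat n n" "V \<in> carrier_mat n n" using u v by auto
    show ?thesis using that c by (simp add: assoc_mult_mat[of _ n n _ n _ n])
  qed
  have "(transpose_mat V * U) * mat_diag n d * (transpose_mat U * U)
      = (transpose_mat V * V) * mat_diag n e * (transpose_mat V * U)"
    unfolding conj[of U "mat_diag n d", OF u(6) u(5), symmetric]
      conj[of V "mat_diag n e", OF v(6) v(5), symmetric]
    using u(3) v(3) by simp
  then have "Q * mat_diag n d * 1\<^sub>m n = 1\<^sub>m n * mat_diag n e * Q"
    by (simp only: Q_def u(2) v(2))
  then have comm: "Q * mat_diag n d = mat_diag n e * Q"
    using Q by (metis left_mult_one_mat mat_diag_dim mult_carrier_mat right_mult_one_mat)
  have ent: "Q $$ (i, j) * d j = e i * Q $$ (i, j)" if "i < n" "j < n" for i j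
    using arg_cong[OF comm, of "\<lambda>X. X $$ (i, j)"] that
    by (simp add: mat_diag_mult_left[OF Q] mat_diag_mult_right[OF Q])
  have comm': "Q * mat_diag n (\<lambda>i. d i powr b) = mat_diag n (\<lambda>i. e i powr b) * Q"
  proof (rule eq_matI)
    fix i j
    assume "i < dim_row (mat_diag n (\<lambda>i. e i powr b) * Q)"
      and "j < dim_col (mat_diag n (\<lambda>i. e i powr b) * Q)"
    then have ij: "i < n" "j < n"
      using Q by (auto simp: mat_diag_def)
    then show "(Q * mat_diag n (\<lambda>i. d i powr b)) $$ (i, j)
             = (mat_diag n (\<lambda>i. e i powr b) * Q) $$ (i, j)"
      using ent[OF ij]
      by (cases "Q $$ (i, j) = 0")
         (simp_all add: mat_diag_mult_left[OF Q] mat_diag_mult_right[OF Q])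
  qed (use Q in \<open>auto simp: mat_diag_def\<close>)
  let ?D = "mat_diag n (\<lambda>i. d i powr b)" and ?E = "mat_diag n (\<lambda>i. e i powr b)"
  have c: "U \<in> carrier_mat n n" "V \<in> carrier_mat n n" using u v by auto
  have "U * ?D * transpose_mat U = V * (Q * ?D) * transpose_mat U"
    using VQ c Q by (simp add: assoc_mult_mat[of _ n n _ n _ n, symmetric])
  also have "\<dots> = V * ?E * (Q * transpose_mat U)"
    unfolding comm' using c Q
    by (simp add: assoc_mult_mat[of _ n n _ n _ n] mult_carrier_mat[of _ n n _ n])
  finally show ?thesis by (simp add: QU)
qed

lemma mat_powr_eqI:
  assumes "similar_mat_wit A (mat_diag (dim_row A) d) U (transpose_mat U)"
  shows "mat_powr A b = U * mat_diag (dim_row A) (\<lambda>i. d i powr b) * transpose_mat U"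
  unfolding mat_powr_def
  by (rule the_equality) (use assms spectral_powr_unique in blast)+

lemma mat_powr_mat_diag: "mat_powr (mat_diag n d) b = mat_diag n (\<lambda>i. d i powr b)"
proof -
  have dim: "dim_row (mat_diag n d) = n" by (simp add: mat_diag_def)
  have "similar_mat_wit (mat_diag n d) (mat_diag n d) (1\<^sub>m n) (transpose_mat (1\<^sub>m n))"
    by (rule similar_mat_witI[of _ _ n])
       (simp_all add: right_mult_one_mat[OF mat_diag_dim] left_mult_one_mat[OF mat_diag_dim])
  with mat_powr_eqI[of "mat_diag n d" d "1\<^sub>m n" b] dim show ?thesis
    by (simp add: right_mult_one_mat[OF mat_diag_dim] left_mult_one_mat[OF mat_diag_dim])
qed

definition adjacency_matrix :: "nat \<Rightarrow> real mat \<Rightarrow> bool" where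
  "adjacency_matrix N W \<longleftrightarrow> W \<in> carrier_mat N N \<and>
     (\<forall>i<N. \<forall>j<N. W $$ (i, j) = W $$ (j, i) \<and> W $$ (i, j) \<ge> 0) \<and>
     (\<forall>i<N. W $$ (i, i) = 0)"

definition degree_matrix :: "nat \<Rightarrow> real mat \<Rightarrow> real mat" where
  "degree_matrix N W = mat_diag N (\<lambda>i. \<Sum>j<N. W $$ (i, j))"

definition graph_laplacian :: "nat \<Rightarrow> real \<Rightarrow> real mat \<Rightarrow> real mat" where
  "graph_laplacian N p W =
     mat_powr (degree_matrix N W) (- p) * (degree_matrix N W - W) *
     mat_powr (degree_matrix N W) (- p)"

definition regularizer :: "nat \<Rightarrow> real \<Rightarrow> real \<Rightarrow> real mat \<Rightarrow> real mat \<Rightarrow> real" where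
  "regularizer N \<tau> \<beta> L \<Theta> = frob_inner \<Theta> (mat_powr (L + \<tau> \<cdot>\<^sub>m 1\<^sub>m N) \<beta> * \<Theta>)"

definition row_extraction :: "nat \<Rightarrow> nat \<Rightarrow> real mat" where
  "row_extraction M N = mat M N (\<lambda>(i, j). if i = j then 1 else 0)"

definition displacement_matrix ::
    "nat \<Rightarrow> nat \<Rightarrow> (nat \<Rightarrow> real vec) \<Rightarrow> (nat \<Rightarrow> real vec) \<Rightarrow> real mat" where
  "displacement_matrix K D x y = mat K D (\<lambda>(i, j). x i $ j - y i $ j)"

end

theory Submission
  imports Defs "Jordan_Normal_Form.Spectral_Radius"
begin

text \<open>
  By the spectral theorem \<open>S = (L + \<tau> I)\<^sup>\<beta>\<close> is symmetric and \<open>\<langle>\<Theta>, S \<Theta>\<rangle> \<ge> \<tau>\<^sup>\<beta> \<parallel>\<Theta>\<parallel>\<^sup>2\<close>. Hence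
  \<open>P S\<^sup>-\<^sup>1 P\<^sup>T\<close> is invertible, and the constrained problem is solved by \<open>X = S\<^sup>-\<^sup>1 P\<^sup>T \<Lambda>\<close> with
  \<open>\<Lambda> = (P S\<^sup>-\<^sup>1 P\<^sup>T)\<^sup>-\<^sup>1 P \<Phi>\<close>, so that \<open>S X = P\<^sup>T \<Lambda>\<close>. Comparing the Tikhonov functional at its
  minimizer \<open>Z\<close> and at \<open>X\<close>, expanding \<open>\<R>(Z)\<close> around \<open>X\<close> and moving \<open>S X = P\<^sup>T \<Lambda>\<close> to the data
  side gives \<open>\<R>(Z - X) \<le> 3/2 \<delta>\<^sup>2/\<omega> + 3 \<omega> \<parallel>\<Lambda>\<parallel>\<^sup>2\<close>, which tends to \<open>0\<close>; no compactness is needed.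
\<close>

section \<open>The spectral theorem for real symmetric matrices\<close>

lemma scalar_prod_self_pos:
  fixes v :: "real vec"
  assumes "v \<in> carrier_vec n" "v \<noteq> 0\<^sub>v n"
  shows "v \<bullet> v > 0"
  using conjugate_square_greater_0_vec[OF assms(1)] assms(2) by simp

text \<open>A complex eigenpair exists because the complex spectrum is nonempty. Symmetry forces the
  eigenvalue to be real, and then the real and imaginary parts of the eigenvector satisfy the same
  real equation; at least one of them is nonzero.\<close>

lemma symmetric_real_eigenvector:
  fixes A :: "real mat"
  assumes A: "A \<in> carrier_mat n n" and sym: "transpose_mat A = A" and n: "n > 0"
  obtains v e where "v \<in> carrier_vec n" "v \<noteq> 0\<^sub>v n" "A *\<^sub>v v = e \<cdot>\<^sub>v v"
proof -
  define C where "C = map_mat complex_of_real A"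
  have C: "C \<in> carrier_mat n n" using A by (simp add: C_def)
  obtain k z where z: "z \<in> carrier_vec n" "z \<noteq> 0\<^sub>v n" and Cz: "C *\<^sub>v z = k \<cdot>\<^sub>v z"
    using spectrum_non_empty[OF C n] C
    by (auto simp: spectrum_def eigenvalue_def eigenvector_def)
  define x y where "x = map_vec Re z" and "y = map_vec Im z"
  have x: "x \<in> carrier_vec n" and y: "y \<in> carrier_vec n" using z by (auto simp: x_def y_def)
  have ent: "(\<Sum>j<n. complex_of_real (A $$ (i, j)) * z $ j) = k * z $ i" if "i < n" for i
    using arg_cong[OF Cz, of "\<lambda>v. v $ i"] that A C z
    by (simp add: C_def scalar_prod_def atLeast0LessThan)
  have Ax: "A *\<^sub>v x = Re k \<cdot>\<^sub>v x - Im k \<cdot>\<^sub>v y"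
  proof (rule eq_vecI)
    fix i assume "i < dim_vec (Re k \<cdot>\<^sub>v x - Im k \<cdot>\<^sub>v y)"
    then have i: "i < n" using y by simp
    show "(A *\<^sub>v x) $ i = (Re k \<cdot>\<^sub>v x - Im k \<cdot>\<^sub>v y) $ i"
      using arg_cong[OF ent[OF i], of Re] i A z
      by (simp add: x_def y_def scalar_prod_def atLeast0LessThan)
  qed (use A y in auto)
  have Ay: "A *\<^sub>v y = Im k \<cdot>\<^sub>v x + Re k \<cdot>\<^sub>v y"
  proof (rule eq_vecI)
    fix i assume "i < dim_vec (Im k \<cdot>\<^sub>v x + Re k \<cdot>\<^sub>v y)"
    then have i: "i < n" using y by simp
    show "(A *\<^sub>v y) $ i = (Im k \<cdot>\<^sub>v x + Re k \<cdot>\<^sub>v y) $ i"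
      using arg_cong[OF ent[OF i], of Im] i A z
      by (simp add: x_def y_def scalar_prod_def atLeast0LessThan)
  qed (use A y in auto)
  have nz: "x \<noteq> 0\<^sub>v n \<or> y \<noteq> 0\<^sub>v n"
  proof (rule ccontr)
    assume "\<not> ?thesis"
    then have "x $ i = 0 \<and> y $ i = 0" if "i < n" for i using that by simp
    then have "z = 0\<^sub>v n"
      using z(1) by (intro eq_vecI) (auto simp: x_def y_def complex_eq_iff)
    with z(2) show False by simp
  qed
  \<comment> \<open>With \<open>Ax\<close> and \<open>Ay\<close> inserted, the terms
    \<open>Re k * (x \<bullet> y)\<close> cancel and only the multiple of \<open>Im k\<close>
    survives.\<close>
  have "x \<bullet> (A *\<^sub>v y) = (A *\<^sub>v x) \<bullet> y"
    using transpose_vec_mult_scalar[OF A y x] sym by simp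
  then have "Im k * (x \<bullet> x + y \<bullet> y) = 0"
    unfolding Ax Ay using x y
    by (simp add: scalar_prod_add_distrib[of _ n] minus_scalar_prod_distrib[of _ n] algebra_simps)
  moreover have "x \<bullet> x + y \<bullet> y > 0"
    using nz scalar_prod_self_pos[OF x] scalar_prod_self_pos[OF y]
      conjugate_square_ge_0_vec[of x] conjugate_square_ge_0_vec[of y] by simp linarith
  ultimately have "Im k = 0" by simp
  with Ax Ay x y have "A *\<^sub>v x = Re k \<cdot>\<^sub>v x" "A *\<^sub>v y = Re k \<cdot>\<^sub>v y"
    by (auto intro!: eq_vecI)
  with nz x y that show thesis by blast
qed

text \<open>The reflection \<open>I - s w w^T\<close>, with \<open>w\<close> the normalized
  \<open>v\<close> minus the first unit vector, exchanges these two unit vectors. Being symmetric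
  and involutory, it is its own transpose and inverse, so conjugating by it is an orthogonal
  similarity.\<close>

lemma orthogonal_reflection_exists:
  fixes v :: "real vec"
  assumes v: "v \<in> carrier_vec n" and v0: "v \<noteq> 0\<^sub>v n" and n: "n > 0"
  obtains H c where "H \<in> carrier_mat n n" "transpose_mat H = H" "H * H = 1\<^sub>m n"
    "H *\<^sub>v unit_vec n 0 = c \<cdot>\<^sub>v v"
proof -
  define c where "c = 1 / sqrt (v \<bullet> v)"
  have vv: "v \<bullet> v > 0" by (rule scalar_prod_self_pos[OF v v0])
  have c: "c * c * (v \<bullet> v) = 1" using vv by (auto simp: c_def)
  define w where "w = c \<cdot>\<^sub>v v - unit_vec n 0"
  have w: "w \<in> carrier_vec n" using v by (simp add: w_def)
  \<comment> \<open>\<open>s = 0\<close> makes the Householder reflection below the identity when \<open>v\<close> is already parallel to the first unit vector.\<close>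
  define s where "s = (if w = 0\<^sub>v n then 0 else 2 / (w \<bullet> w))"
  have ww: "w \<bullet> w = 2 - 2 * (c * v $ 0)"
  proof -
    have "w \<bullet> w = c * c * (v \<bullet> v) - 2 * (c * v $ 0) + 1"
      unfolding w_def using v n
      by (simp add: scalar_prod_minus_distrib[of _ n] minus_scalar_prod_distrib[of _ n] algebra_simps)
    with c show ?thesis by simp
  qed
  \<comment> \<open>This identity covers both cases of \<open>s\<close> and is what cancels the
    rank-one terms of \<open>H * H\<close>.\<close>
  have s: "s * s * (w \<bullet> w) = 2 * s"
    using scalar_prod_self_pos[OF w] by (auto simp: s_def)
  define H where "H = mat n n (\<lambda>(i, j). (if i = j then 1 else 0) - s * (w $ i * w $ j))"
  have H: "H \<in> carrier_mat n n" by (simp add: H_def)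
  have "transpose_mat H = H" by (rule eq_matI) (auto simp: H_def)
  moreover have "H * H = 1\<^sub>m n"
  proof (rule eq_matI)
    fix i j assume "i < dim_row (1\<^sub>m n :: real mat)" "j < dim_col (1\<^sub>m n :: real mat)"
    then have ij: "i < n" "j < n" by auto
    have "(H * H) $$ (i, j) = (\<Sum>k<n. H $$ (i, k) * H $$ (k, j))"
      using H ij by (simp add: scalar_prod_def atLeast0LessThan)
    also have "\<dots> = (\<Sum>k<n. (if i = k then if k = j then 1 else 0 else 0)
        - (if i = k then s * (w $ k * w $ j) else 0) - (if k = j then s * (w $ i * w $ k) else 0)
        + s * s * w $ i * w $ j * (w $ k * w $ k))"
      by (rule sum.cong) (use ij in \<open>auto simp: H_def algebra_simps\<close>)
    also have "\<dots> = (if i = j then 1 else 0) - 2 * s * w $ i * w $ j + s * s * (w \<bullet> w) * w $ i * w $ j"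
      using ij w by (simp add: sum.distrib sum_subtractf scalar_prod_def atLeast0LessThan
          flip: sum_distrib_left)
    finally show "(H * H) $$ (i, j) = 1\<^sub>m n $$ (i, j)"
      using ij s by simp
  qed (use H in auto)
  moreover have "H *\<^sub>v unit_vec n 0 = c \<cdot>\<^sub>v v"
  proof (rule eq_vecI)
    fix i assume "i < dim_vec (c \<cdot>\<^sub>v v)"
    then have i: "i < n" using v by simp
    have wi: "w $ i = c * v $ i - (if i = 0 then 1 else 0)" using i v by (simp add: w_def)
    \<comment> \<open>For \<open>w\<close> nonzero, \<open>ww\<close> gives
      \<open>s = 1 / (1 - c * v $ 0)\<close>; for \<open>w\<close> zero the correction term vanishes
      anyway.\<close>
    have sw: "w $ i = 0 \<or> s * (1 - c * v $ 0) = 1"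
    proof (cases "w = 0\<^sub>v n")
      case True then show ?thesis using i by simp
    next
      case False
      from scalar_prod_self_pos[OF w False] False ww show ?thesis by (simp add: s_def field_simps)
    qed
    have "(H *\<^sub>v unit_vec n 0) $ i = H $$ (i, 0)"
      using H i n by simp
    also have "\<dots> = (if i = 0 then 1 else 0) + s * (1 - c * v $ 0) * w $ i"
      using i n v by (simp add: H_def) (simp add: w_def algebra_simps)
    also have "\<dots> = (if i = 0 then 1 else 0) + w $ i" using sw by auto
    finally show "(H *\<^sub>v unit_vec n 0) $ i = (c \<cdot>\<^sub>v v) $ i"
      using i v wi by simp
  qed (use H v in auto)
  ultimately show thesis using that H by blast
qed


text \<open>Deflation, by induction on the dimension: a reflection turns an eigenvector into the
  first unit vector, symmetry then clears the first row as well as the first column, and the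
  remaining block is diagonalized by the induction hypothesis. The form of the conclusion is the one
  that \<open>mat_powr_eqI\<close> consumes.\<close>

lemma real_spectral_decomposition:
  fixes A :: "real mat"
  assumes "A \<in> carrier_mat n n" "transpose_mat A = A"
  obtains U d where "similar_mat_wit A (mat_diag n d) U (transpose_mat U)"
  using assms
proof (induction n arbitrary: A thesis)
  case 0
  have "similar_mat_wit A (mat_diag 0 (\<lambda>_. 0)) (1\<^sub>m 0) (transpose_mat (1\<^sub>m 0))"
    by (rule similar_mat_witI[of _ _ 0]) (use 0 in auto)
  then show ?case by (rule 0)
next
  case (Suc n)
  note A = Suc.prems(2) and sym = Suc.prems(3)
  obtain v e where v: "v \<in> carrier_vec (Suc n)" "v \<noteq> 0\<^sub>v (Suc n)" and Av: "A *\<^sub>v v = e \<cdot>\<^sub>v v"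
    using symmetric_real_eigenvector[OF A sym] by blast
  obtain H c where H: "H \<in> carrier_mat (Suc n) (Suc n)" "transpose_mat H = H" "H * H = 1\<^sub>m (Suc n)"
    and He: "H *\<^sub>v unit_vec (Suc n) 0 = c \<cdot>\<^sub>v v"
    using orthogonal_reflection_exists[OF v] by blast
  define B where "B = H * A * H"
  have B: "B \<in> carrier_mat (Suc n) (Suc n)" using A H by (simp add: B_def)
  have AB: "similar_mat_wit A B H H"
    by (rule similar_mat_wit_sym, rule similar_mat_witI[of _ _ "Suc n"])
      (use H A B in \<open>auto simp: B_def\<close>)
  have symB: "transpose_mat B = B"
    using A H(1) by (simp add: B_def transpose_mult[of _ "Suc n" "Suc n" _ "Suc n"] H(2) sym
        assoc_mult_mat[of _ "Suc n" "Suc n" _ "Suc n" _ "Suc n"])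
  have "B *\<^sub>v unit_vec (Suc n) 0 = H *\<^sub>v (A *\<^sub>v (H *\<^sub>v unit_vec (Suc n) 0))"
    using A H(1) by (simp add: B_def assoc_mult_mat_vec[of _ "Suc n" "Suc n" _ "Suc n"])
  also have "\<dots> = e \<cdot>\<^sub>v (H *\<^sub>v (c \<cdot>\<^sub>v v))"
    using A H(1) v Av
    by (simp add: He mult_mat_vec[of _ "Suc n" "Suc n"] smult_smult_assoc mult.commute)
  also have "H *\<^sub>v (c \<cdot>\<^sub>v v) = (H * H) *\<^sub>v unit_vec (Suc n) 0"
    using H(1) by (simp add: He assoc_mult_mat_vec[of _ "Suc n" "Suc n" _ "Suc n"])
  finally have Be: "B *\<^sub>v unit_vec (Suc n) 0 = e \<cdot>\<^sub>v unit_vec (Suc n) 0"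
    using H(3) by simp
  have B0: "B $$ (i, 0) = (if i = 0 then e else 0)" if "i < Suc n" for i
    using arg_cong[OF Be, of "\<lambda>x. x $ i"] that B by simp
  have B0': "B $$ (0, i) = (if i = 0 then e else 0)" if "i < Suc n" for i
    using B0[OF that] arg_cong[OF symB, of "\<lambda>X. X $$ (i, 0)"] that B by simp
  define E C where "E = mat 1 1 (\<lambda>_. e)" and "C = mat n n (\<lambda>(i, j). B $$ (Suc i, Suc j))"
  have EC: "E \<in> carrier_mat 1 1" "C \<in> carrier_mat n n" by (auto simp: E_def C_def)
  have Bblock: "B = four_block_mat E (0\<^sub>m 1 n) (0\<^sub>m n 1) C"
    by (rule eq_matI) (use B B0 B0' in \<open>auto simp: E_def C_def\<close>)
  have "transpose_mat C = C"
  proof (rule eq_matI)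
    fix i j assume "i < dim_row C" "j < dim_col C"
    then show "transpose_mat C $$ (i, j) = C $$ (i, j)"
      using arg_cong[OF symB, of "\<lambda>X. X $$ (Suc i, Suc j)"] B by (simp add: C_def)
  qed (auto simp: C_def)
  then obtain U d where U: "similar_mat_wit C (mat_diag n d) U (transpose_mat U)"
    using Suc.IH EC(2) by blast
  then have Uc: "U \<in> carrier_mat n n" using similar_mat_witD2[OF EC(2)] by blast
  let ?V = "four_block_mat (1\<^sub>m 1) (0\<^sub>m 1 n) (0\<^sub>m n 1) U"
  have "similar_mat_wit (four_block_mat E (0\<^sub>m 1 n) (0\<^sub>m n 1) C)
      (four_block_mat E (0\<^sub>m 1 n) (0\<^sub>m n 1) (mat_diag n d))
      ?V (four_block_mat (1\<^sub>m 1) (0\<^sub>m 1 n) (0\<^sub>m n 1) (transpose_mat U))"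
    by (rule similar_mat_wit_four_block[OF similar_mat_wit_refl[OF EC(1)] U _ _ EC])
      (use Uc in auto)
  also have "four_block_mat (1\<^sub>m 1) (0\<^sub>m 1 n) (0\<^sub>m n 1) (transpose_mat U) = transpose_mat ?V"
    using Uc by (subst transpose_four_block_mat[of _ 1 1 _ n _ n]) auto
  \<comment> \<open>\<open>case_nat e d\<close> places the split-off eigenvalue at index 0 and
    shifts the others by one.\<close>
  also have "four_block_mat E (0\<^sub>m 1 n) (0\<^sub>m n 1) (mat_diag n d)
      = mat_diag (Suc n) (case_nat e d)"
    by (rule eq_matI) (auto simp: E_def mat_diag_def split: nat.splits)
  finally have "similar_mat_wit B (mat_diag (Suc n) (case_nat e d)) ?V (transpose_mat ?V)"
    unfolding Bblock[symmetric] .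
  from similar_mat_wit_trans[OF AB this]
  have "similar_mat_wit A (mat_diag (Suc n) (case_nat e d)) (H * ?V) (transpose_mat ?V * H)" .
  also have "transpose_mat ?V * H = transpose_mat (H * ?V)"
    using H Uc by (subst transpose_mult[of _ "Suc n" "Suc n" _ "Suc n"]) auto
  finally show ?case by (rule Suc.prems(1))
qed

section \<open>Coercive matrices and the graph Laplacian\<close>

text \<open>In the coordinates \<open>transpose_mat U *\<^sub>v v\<close> the quadratic form is a
  weighted sum of squares.\<close>

lemma scalar_prod_mat_diag_conj:
  fixes U :: "real mat"
  assumes U: "U \<in> carrier_mat n n" and v: "v \<in> carrier_vec n"
  shows "v \<bullet> ((U * mat_diag n d * transpose_mat U) *\<^sub>v v)
    = (\<Sum>i<n. d i * ((transpose_mat U *\<^sub>v v) $ i)\<^sup>2)"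
proof -
  define y where "y = transpose_mat U *\<^sub>v v"
  have y: "y \<in> carrier_vec n" using U v by (simp add: y_def)
  have "(U * mat_diag n d * transpose_mat U) *\<^sub>v v = U *\<^sub>v (mat_diag n d *\<^sub>v y)"
    using U v by (simp add: y_def assoc_mult_mat_vec[of _ n n _ n])
  then have "v \<bullet> ((U * mat_diag n d * transpose_mat U) *\<^sub>v v) = y \<bullet> (mat_diag n d *\<^sub>v y)"
    using transpose_vec_mult_scalar[OF U mult_mat_vec_carrier[OF mat_diag_dim y] v] by (simp add: y_def)
  also have "mat_diag n d *\<^sub>v y = vec n (\<lambda>i. d i * y $ i)"
    using y by (intro eq_vecI)
      (auto simp: mat_diag_def scalar_prod_def if_distrib[of "\<lambda>x. x * _"] cong: if_cong)
  finally show ?thesis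
    using y by (simp add: scalar_prod_def y_def[symmetric] atLeast0LessThan power2_eq_square mult_ac)
qed

lemma spectral_decomposition_D:
  fixes A :: "real mat"
  assumes A: "A \<in> carrier_mat n n"
    and dec: "similar_mat_wit A (mat_diag n d) U (transpose_mat U)"
  shows "U \<in> carrier_mat n n" "U * transpose_mat U = 1\<^sub>m n" "transpose_mat U * U = 1\<^sub>m n"
    "A = U * mat_diag n d * transpose_mat U"
  using similar_mat_witD2[OF A dec] by blast+

lemma orthogonal_mat_norm_transpose:
  fixes U :: "real mat"
  assumes U: "U \<in> carrier_mat n n" "U * transpose_mat U = 1\<^sub>m n" and v: "v \<in> carrier_vec n"
  shows "(\<Sum>i<n. ((transpose_mat U *\<^sub>v v) $ i)\<^sup>2) = v \<bullet> v"
  using scalar_prod_mat_diag_conj[OF U(1) v, of "\<lambda>_. 1"] U v by simp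

text \<open>The lower bound is tested on column \<open>i\<close> of \<open>U\<close>, a unit vector
  whose coordinates in the eigenbasis are the \<open>i\<close>-th unit vector.\<close>

lemma eigenvalue_ge:
  fixes A :: "real mat"
  assumes A: "A \<in> carrier_mat n n"
    and dec: "similar_mat_wit A (mat_diag n d) U (transpose_mat U)"
    and ge: "\<And>v. v \<in> carrier_vec n \<Longrightarrow> c * (v \<bullet> v) \<le> v \<bullet> (A *\<^sub>v v)"
    and i: "i < n"
  shows "c \<le> d i"
proof -
  note U = spectral_decomposition_D[OF A dec]
  define v where "v = col U i"
  have v: "v \<in> carrier_vec n" using U(1) i by (auto simp: v_def)
  have ent: "(transpose_mat U *\<^sub>v v) $ j = (if i = j then 1 else 0)" if "j < n" for j
    using arg_cong[OF U(3), of "\<lambda>X. X $$ (j, i)"] U(1) i that by (auto simp: v_def)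
  have "v \<bullet> (A *\<^sub>v v) = (\<Sum>j<n. d j * ((transpose_mat U *\<^sub>v v) $ j)\<^sup>2)"
    unfolding U(4) using U(1) v by (rule scalar_prod_mat_diag_conj)
  also have "\<dots> = (\<Sum>j<n. if i = j then d j else 0)"
    by (rule sum.cong) (auto simp: ent)
  also have "\<dots> = d i" using i by simp
  finally have 1: "v \<bullet> (A *\<^sub>v v) = d i" .
  have "v \<bullet> v = (\<Sum>j<n. ((transpose_mat U *\<^sub>v v) $ j)\<^sup>2)"
    using orthogonal_mat_norm_transpose[OF U(1,2) v] by simp
  also have "\<dots> = (\<Sum>j<n. if i = j then 1 else 0)"
    by (rule sum.cong) (auto simp: ent)
  also have "\<dots> = 1" using i by simp
  finally show ?thesis using ge[OF v] 1 by simp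
qed

text \<open>Converse to \<open>eigenvalue_ge\<close>. Together they carry a lower bound on a form to
  functions of the matrix: pass to the eigenvalues, apply the function, return.\<close>

lemma scalar_prod_mat_diag_conj_ge:
  fixes U :: "real mat"
  assumes U: "U \<in> carrier_mat n n" "U * transpose_mat U = 1\<^sub>m n" and v: "v \<in> carrier_vec n"
    and ge: "\<And>i. i < n \<Longrightarrow> c \<le> d i"
  shows "c * (v \<bullet> v) \<le> v \<bullet> ((U * mat_diag n d * transpose_mat U) *\<^sub>v v)"
  unfolding scalar_prod_mat_diag_conj[OF U(1) v] orthogonal_mat_norm_transpose[OF U v, symmetric]
    sum_distrib_left
  by (rule sum_mono) (use ge in \<open>auto intro: mult_right_mono\<close>)

lemma transpose_mat_diag_conj:
  fixes U :: "real mat"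
  assumes U: "U \<in> carrier_mat n n"
  shows "transpose_mat (U * mat_diag n d * transpose_mat U) = U * mat_diag n d * transpose_mat U"
proof -
  have "transpose_mat (mat_diag n d) = mat_diag n d" by (rule eq_matI) (auto simp: mat_diag_def)
  then show ?thesis
    using U by (simp add: transpose_mult[of _ n n _ n] assoc_mult_mat[of _ n n _ n _ n]
        mult_carrier_mat[of _ n n _ n])
qed

lemma mat_diag_conj_inverse:
  fixes U :: "real mat"
  assumes U: "U \<in> carrier_mat n n" "U * transpose_mat U = 1\<^sub>m n" "transpose_mat U * U = 1\<^sub>m n"
    and nz: "\<And>i. i < n \<Longrightarrow> d i \<noteq> 0"
  shows "(U * mat_diag n d * transpose_mat U) * (U * mat_diag n (\<lambda>i. 1 / d i) * transpose_mat U) = 1\<^sub>m n"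
proof -
  have *: "mat_diag n d * mat_diag n (\<lambda>i. 1 / d i) = 1\<^sub>m n"
    unfolding mat_diag_diag by (rule eq_matI) (use nz in \<open>auto simp: mat_diag_def\<close>)
  have "(U * mat_diag n d * transpose_mat U) * (U * mat_diag n (\<lambda>i. 1 / d i) * transpose_mat U)
     = U * mat_diag n d * (transpose_mat U * U) * mat_diag n (\<lambda>i. 1 / d i) * transpose_mat U"
    using U(1) by (simp add: assoc_mult_mat[of _ n n _ n _ n] mult_carrier_mat[of _ n n _ n])
  also have "\<dots> = U * (mat_diag n d * mat_diag n (\<lambda>i. 1 / d i)) * transpose_mat U"
    using U(1) unfolding U(3) by (simp add: assoc_mult_mat[of _ n n _ n _ n] mult_carrier_mat[of _ n n _ n]
        left_mult_one_mat[of _ n n] del: mat_diag_diag)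
  finally show ?thesis using U(1,2) unfolding * by simp
qed

text \<open>Take reciprocals of the eigenvalues, all of which are at least \<open>c\<close>. The
  bound for the inverse is included because the compression \<open>P * T * transpose_mat P\<close>
  of such an inverse \<open>T\<close> has to be inverted in turn.\<close>

lemma coercive_inverse:
  fixes A :: "real mat"
  assumes A: "A \<in> carrier_mat n n" "transpose_mat A = A"
    and c: "c > 0" and ge: "\<And>v. v \<in> carrier_vec n \<Longrightarrow> c * (v \<bullet> v) \<le> v \<bullet> (A *\<^sub>v v)"
  obtains B c' where "B \<in> carrier_mat n n" "transpose_mat B = B" "A * B = 1\<^sub>m n"
    "c' > 0" "\<And>v. v \<in> carrier_vec n \<Longrightarrow> c' * (v \<bullet> v) \<le> v \<bullet> (B *\<^sub>v v)"
proof -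
  obtain U d where dec: "similar_mat_wit A (mat_diag n d) U (transpose_mat U)"
    using real_spectral_decomposition[OF A] by blast
  note U = spectral_decomposition_D[OF A(1) dec]
  have d: "d i \<ge> c" if "i < n" for i
    using eigenvalue_ge[OF A(1) dec ge that] .
  define B where "B = U * mat_diag n (\<lambda>i. 1 / d i) * transpose_mat U"
  \<comment> \<open>Inserting 1 keeps the set nonempty when \<open>n = 0\<close>; it can only lower
    the minimum.\<close>
  define c' where "c' = Min (insert 1 ((\<lambda>i. 1 / d i) ` {..<n}))"
  have "c' > 0" unfolding c'_def
    using d c by (subst Min_gr_iff) (auto intro: order.strict_trans2)
  moreover have "c' \<le> 1 / d i" if "i < n" for i
    unfolding c'_def using that by (intro Min_le) auto
  then have "c' * (v \<bullet> v) \<le> v \<bullet> (B *\<^sub>v v)" if "v \<in> carrier_vec n" for v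
    unfolding B_def using U that by (intro scalar_prod_mat_diag_conj_ge) auto
  moreover have "A * B = 1\<^sub>m n"
    unfolding U(4) B_def
    by (rule mat_diag_conj_inverse[OF U(1,2,3)]) (use d c in fastforce)
  moreover have "transpose_mat B = B" "B \<in> carrier_mat n n"
    using transpose_mat_diag_conj[OF U(1)] U(1) by (auto simp: B_def)
  ultimately show thesis using that by blast
qed

text \<open>The eigenvectors stay, and \<open>x powr b\<close> is monotone on positive reals for
  \<open>b \<ge> 0\<close>, so the eigenvalue bound \<open>c\<close> becomes
  \<open>c powr b\<close>.\<close>

lemma coercive_mat_powr:
  fixes A :: "real mat"
  assumes A: "A \<in> carrier_mat n n" "transpose_mat A = A"
    and c: "c > 0" and b: "b \<ge> 0"
    and ge: "\<And>v. v \<in> carrier_vec n \<Longrightarrow> c * (v \<bullet> v) \<le> v \<bullet> (A *\<^sub>v v)"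
  shows "mat_powr A b \<in> carrier_mat n n" "transpose_mat (mat_powr A b) = mat_powr A b"
    "\<And>v. v \<in> carrier_vec n \<Longrightarrow> c powr b * (v \<bullet> v) \<le> v \<bullet> (mat_powr A b *\<^sub>v v)"
proof -
  obtain U d where dec: "similar_mat_wit A (mat_diag n d) U (transpose_mat U)"
    using real_spectral_decomposition[OF A] by blast
  note U = spectral_decomposition_D[OF A(1) dec]
  have powr: "mat_powr A b = U * mat_diag n (\<lambda>i. d i powr b) * transpose_mat U"
    using mat_powr_eqI[of A d U b] dec A(1) by simp
  show "mat_powr A b \<in> carrier_mat n n" "transpose_mat (mat_powr A b) = mat_powr A b"
    unfolding powr using transpose_mat_diag_conj[OF U(1)] U(1) by auto
  have "c powr b \<le> d i powr b" if "i < n" for i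
    using eigenvalue_ge[OF A(1) dec ge that] b c by (intro powr_mono2) auto
  then show "c powr b * (v \<bullet> v) \<le> v \<bullet> (mat_powr A b *\<^sub>v v)" if "v \<in> carrier_vec n" for v
    unfolding powr using U that by (intro scalar_prod_mat_diag_conj_ge) auto
qed

section \<open>Positivity of the graph Laplacian\<close>

text \<open>Twice the form is the Dirichlet energy, the sum of
  \<open>W $$ (i, j) * (v $ i - v $ j)\<^sup>2\<close> with nonnegative weights.\<close>

lemma degree_minus_adjacency_nonneg:
  assumes W: "adjacency_matrix N W" and v: "v \<in> carrier_vec N"
  shows "0 \<le> v \<bullet> ((degree_matrix N W - W) *\<^sub>v v)"
proof -
  have Wc: "W \<in> carrier_mat N N" and Ws: "\<And>i j. i < N \<Longrightarrow> j < N \<Longrightarrow> W $$ (i, j) = W $$ (j, i)"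
    and Wn: "\<And>i j. i < N \<Longrightarrow> j < N \<Longrightarrow> 0 \<le> W $$ (i, j)"
    using W by (auto simp: adjacency_matrix_def)
  have "((degree_matrix N W - W) *\<^sub>v v) $ i = (\<Sum>j<N. W $$ (i, j) * (v $ i - v $ j))" if "i < N" for i
  proof -
    have "((degree_matrix N W - W) *\<^sub>v v) $ i
      = (\<Sum>j<N. (if i = j then (\<Sum>k<N. W $$ (j, k)) * v $ j else 0) - W $$ (i, j) * v $ j)"
      using that v Wc unfolding degree_matrix_def mat_diag_def
      by (auto simp: scalar_prod_def atLeast0LessThan algebra_simps intro!: sum.cong)
    then show ?thesis
      using that by (simp add: sum_subtractf sum_distrib_right right_diff_distrib)
  qed
  then have Q: "v \<bullet> ((degree_matrix N W - W) *\<^sub>v v)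
      = (\<Sum>i<N. \<Sum>j<N. W $$ (i, j) * (v $ i * (v $ i - v $ j)))"
    using v Wc by (simp add: scalar_prod_def atLeast0LessThan sum_distrib_left mult_ac)
  \<comment> \<open>Exchanging the roles of \<open>i\<close> and \<open>j\<close>, by symmetry of
    \<open>W\<close>; adding the two versions produces the squares.\<close>
  also have "\<dots> = (\<Sum>i<N. \<Sum>j<N. W $$ (i, j) * (v $ j * (v $ j - v $ i)))"
    by (subst sum.swap) (simp add: Ws)
  finally have "2 * (v \<bullet> ((degree_matrix N W - W) *\<^sub>v v))
      = (\<Sum>i<N. \<Sum>j<N. W $$ (i, j) * (v $ i * (v $ i - v $ j)))
        + (\<Sum>i<N. \<Sum>j<N. W $$ (i, j) * (v $ j * (v $ j - v $ i)))"
    using Q by simp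
  also have "\<dots> = (\<Sum>i<N. \<Sum>j<N. W $$ (i, j) * (v $ i - v $ j)\<^sup>2)"
    unfolding sum.distrib[symmetric]
    by (intro sum.cong refl) (simp add: power2_eq_square algebra_simps)
  also have "\<dots> \<ge> 0" by (intro sum_nonneg) (simp add: Wn)
  finally show ?thesis by simp
qed

text \<open>The normalization is a congruence by the diagonal, hence symmetric, matrix
  \<open>K\<close>: the form at \<open>v\<close> is that of \<open>G\<close> at
  \<open>K *\<^sub>v v\<close>.\<close>

lemma graph_laplacian_psd:
  assumes W: "adjacency_matrix N W"
  shows "graph_laplacian N p W \<in> carrier_mat N N"
    "transpose_mat (graph_laplacian N p W) = graph_laplacian N p W"
    "\<And>v. v \<in> carrier_vec N \<Longrightarrow> 0 \<le> v \<bullet> (graph_laplacian N p W *\<^sub>v v)"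
proof -
  define K where "K = mat_powr (degree_matrix N W) (- p)"
  define G where "G = degree_matrix N W - W"
  have L: "graph_laplacian N p W = K * G * K" by (simp add: graph_laplacian_def K_def G_def)
  have K: "K \<in> carrier_mat N N" "transpose_mat K = K"
    by (auto simp: K_def degree_matrix_def mat_powr_mat_diag) (auto simp: mat_diag_def)
  have G: "G \<in> carrier_mat N N" "transpose_mat G = G"
    using W by (auto simp: G_def degree_matrix_def mat_diag_def adjacency_matrix_def)
  show "graph_laplacian N p W \<in> carrier_mat N N" using K G by (simp add: L)
  show "transpose_mat (graph_laplacian N p W) = graph_laplacian N p W"
    using K(1) G(1)
    by (simp add: L transpose_mult[of _ N N _ N] K(2) G(2) assoc_mult_mat[of _ N N _ N _ N])
  fix v :: "real vec" assume v: "v \<in> carrier_vec N"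
  have "v \<bullet> (graph_laplacian N p W *\<^sub>v v) = v \<bullet> (K *\<^sub>v (G *\<^sub>v (K *\<^sub>v v)))"
    using K G v by (simp add: L assoc_mult_mat_vec[of _ N N _ N])
  also have "\<dots> = (K *\<^sub>v v) \<bullet> (G *\<^sub>v (K *\<^sub>v v))"
    using transpose_vec_mult_scalar[OF K(1) _ v, of "G *\<^sub>v (K *\<^sub>v v)"] K G v by simp
  also have "\<dots> \<ge> 0"
    unfolding G_def using K(1) v by (intro degree_minus_adjacency_nonneg[OF W]) simp
  finally show "0 \<le> v \<bullet> (graph_laplacian N p W *\<^sub>v v)" .
qed

section \<open>The Frobenius inner product\<close>

lemma frob_inner_eq_cols:
  assumes "X \<in> carrier_mat n m" "Y \<in> carrier_mat n m"
  shows "frob_inner X Y = (\<Sum>j<m. col X j \<bullet> col Y j)"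
  using assms by (simp add: frob_inner_def mat_trace_def)

lemma frob_inner_eq_sum:
  assumes "X \<in> carrier_mat n m" "Y \<in> carrier_mat n m"
  shows "frob_inner X Y = (\<Sum>j<m. \<Sum>i<n. X $$ (i, j) * Y $$ (i, j))"
  unfolding frob_inner_eq_cols[OF assms]
  using assms by (intro sum.cong) (auto simp: scalar_prod_def atLeast0LessThan)

lemma frob_inner_commute:
  assumes "X \<in> carrier_mat n m" "Y \<in> carrier_mat n m"
  shows "frob_inner X Y = frob_inner Y X"
  using assms by (simp add: frob_inner_eq_sum[of _ n m] mult.commute)

lemma frob_inner_add_left:
  assumes "X \<in> carrier_mat n m" "Y \<in> carrier_mat n m" "Z \<in> carrier_mat n m"
  shows "frob_inner (X + Y) Z = frob_inner X Z + frob_inner Y Z"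
  using assms by (simp add: frob_inner_eq_sum[of _ n m] distrib_right sum.distrib)

lemma frob_inner_add_right:
  assumes "X \<in> carrier_mat n m" "Y \<in> carrier_mat n m" "Z \<in> carrier_mat n m"
  shows "frob_inner Z (X + Y) = frob_inner Z X + frob_inner Z Y"
  using assms by (simp add: frob_inner_eq_sum[of _ n m] distrib_left sum.distrib)

text \<open>Serves to complete squares in \<open>tikhonov_estimate\<close>.\<close>

lemma frob_inner_add_smult_self:
  assumes "X \<in> carrier_mat n m" "Y \<in> carrier_mat n m"
  shows "frob_inner (X + c \<cdot>\<^sub>m Y) (X + c \<cdot>\<^sub>m Y)
    = frob_inner X X + 2 * c * frob_inner X Y + c\<^sup>2 * frob_inner Y Y"
  using assms by (simp add: frob_inner_eq_sum[of _ n m] power2_eq_square algebra_simps sum.distrib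
      sum_distrib_left)

lemma frob_inner_self_nonneg:
  assumes "X \<in> carrier_mat n m"
  shows "0 \<le> frob_inner X X"
  unfolding frob_inner_eq_sum[OF assms assms] by (intro sum_nonneg) simp

lemma frob_inner_self_eq_0:
  assumes X: "X \<in> carrier_mat n m" and 0: "frob_inner X X = 0"
  shows "X = 0\<^sub>m n m"
proof (rule eq_matI)
  fix i j assume "i < dim_row (0\<^sub>m n m :: real mat)" "j < dim_col (0\<^sub>m n m :: real mat)"
  then have ij: "i < n" "j < m" by auto
  have "(\<Sum>i<n. X $$ (i, j) * X $$ (i, j)) = 0"
    using 0 ij unfolding frob_inner_eq_sum[OF X X]
    by (subst (asm) sum_nonneg_eq_0_iff) (auto intro: sum_nonneg)
  then have "X $$ (i, j) * X $$ (i, j) = 0"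
    using ij by (subst (asm) sum_nonneg_eq_0_iff) auto
  then show "X $$ (i, j) = 0\<^sub>m n m $$ (i, j)" using ij by simp
qed (use X in auto)

text \<open>Adjointness; it moves the multiplier term from the solution space to the data
  space.\<close>

lemma frob_inner_mult_left:
  assumes "A \<in> carrier_mat m n" "X \<in> carrier_mat n k" "Y \<in> carrier_mat m k"
  shows "frob_inner (A * X) Y = frob_inner X (transpose_mat A * Y)"
  using assms unfolding frob_inner_def
  by (simp add: transpose_mult[of _ m n] assoc_mult_mat[of _ k n _ m _ k])

lemma frob_norm_power2:
  assumes "X \<in> carrier_mat n m"
  shows "(frob_norm X)\<^sup>2 = frob_inner X X"
  unfolding frob_norm_def using frob_inner_self_nonneg[OF assms] by simp

text \<open>The matrix acts on each column separately, so the vector bound is summed over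
  columns.\<close>

lemma frob_inner_coercive:
  assumes A: "A \<in> carrier_mat n n" and X: "X \<in> carrier_mat n m"
    and ge: "\<And>v. v \<in> carrier_vec n \<Longrightarrow> c * (v \<bullet> v) \<le> v \<bullet> (A *\<^sub>v v)"
  shows "c * frob_inner X X \<le> frob_inner X (A * X)"
proof -
  have "frob_inner X (A * X) = (\<Sum>j<m. col X j \<bullet> (A *\<^sub>v col X j))"
    unfolding frob_inner_eq_cols[OF X mult_carrier_mat[OF A X]]
    by (intro sum.cong) (simp_all only: col_mult2[OF A X] lessThan_iff)
  then show ?thesis
    unfolding frob_inner_eq_cols[OF X X] sum_distrib_left
    using X by (auto intro!: sum_mono ge)
qed

text \<open>Exact second-order expansion around \<open>X\<close>; symmetry of \<open>A\<close>
  merges the two mixed terms.\<close>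

lemma frob_inner_quadratic_add:
  assumes A: "A \<in> carrier_mat n n" "transpose_mat A = A"
    and X: "X \<in> carrier_mat n m" and Y: "Y \<in> carrier_mat n m"
  shows "frob_inner (X + Y) (A * (X + Y))
    = frob_inner X (A * X) + 2 * frob_inner Y (A * X) + frob_inner Y (A * Y)"
proof -
  have AX: "A * X \<in> carrier_mat n m" "A * Y \<in> carrier_mat n m" using A X Y by auto
  have "frob_inner X (A * Y) = frob_inner (A * X) Y"
    using frob_inner_mult_left[OF A(1) X Y] A(2) by simp
  also have "\<dots> = frob_inner Y (A * X)" by (rule frob_inner_commute[OF AX(1) Y])
  finally show ?thesis
    using A(1) X Y AX
    by (simp add: mult_add_distrib_mat[of _ n n _ m] frob_inner_add_left[of _ n m]
        frob_inner_add_right[of _ n m])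
qed

section \<open>Constrained minimizers and Tikhonov regularization\<close>

text \<open>Solves the Lagrange system of the constrained problem. \<open>G\<close> inherits
  coercivity from the inverse \<open>T\<close> of \<open>S\<close>, because
  \<open>P * transpose_mat P = 1\<^sub>m m\<close> makes \<open>transpose_mat P\<close> an isometry;
  hence \<open>G\<close> is invertible for every right-hand side \<open>Y\<close>.\<close>

lemma constrained_minimizer_multiplier_exists:
  fixes S P Y :: "real mat"
  assumes S: "S \<in> carrier_mat n n" "transpose_mat S = S"
    and c: "c > 0" and ge: "\<And>v. v \<in> carrier_vec n \<Longrightarrow> c * (v \<bullet> v) \<le> v \<bullet> (S *\<^sub>v v)"
    and P: "P \<in> carrier_mat m n" "P * transpose_mat P = 1\<^sub>m m"
    and Y: "Y \<in> carrier_mat m k"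
  obtains X \<Lambda> where "X \<in> carrier_mat n k" "\<Lambda> \<in> carrier_mat m k" "P * X = Y"
    "S * X = transpose_mat P * \<Lambda>"
proof -
  let ?Q = "transpose_mat P"
  obtain T c' where T: "T \<in> carrier_mat n n" "transpose_mat T = T" "S * T = 1\<^sub>m n"
    and c': "c' > 0" and geT: "\<And>v. v \<in> carrier_vec n \<Longrightarrow> c' * (v \<bullet> v) \<le> v \<bullet> (T *\<^sub>v v)"
    using coercive_inverse[OF S c ge] by blast
  define G where "G = P * T * ?Q"
  have Q: "?Q \<in> carrier_mat n m" using P by simp
  have G: "G \<in> carrier_mat m m" using P T by (simp add: G_def)
  have symG: "transpose_mat G = G"
    using P(1) T(1) by (simp add: G_def transpose_mult[of _ m n _ m] transpose_mult[of _ n n _ m]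
        T(2) assoc_mult_mat[of _ m n _ n _ m])
  have geG: "c' * (v \<bullet> v) \<le> v \<bullet> (G *\<^sub>v v)" if v: "v \<in> carrier_vec m" for v
  proof -
    have Qv: "?Q *\<^sub>v v \<in> carrier_vec n" using Q v by simp
    have *: "(?Q *\<^sub>v v) \<bullet> x = v \<bullet> (P *\<^sub>v x)" if "x \<in> carrier_vec n" for x
      by (rule transpose_vec_mult_scalar[OF P(1) that v])
    have "v \<bullet> v = v \<bullet> (P *\<^sub>v (?Q *\<^sub>v v))"
      using P v Q by (simp flip: assoc_mult_mat_vec[of _ m n _ m])
    also have "\<dots> = (?Q *\<^sub>v v) \<bullet> (?Q *\<^sub>v v)" using *[OF Qv] by simp
    finally have "c' * (v \<bullet> v) \<le> (?Q *\<^sub>v v) \<bullet> (T *\<^sub>v (?Q *\<^sub>v v))" using geT[OF Qv] by simp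
    also have "\<dots> = v \<bullet> (P *\<^sub>v (T *\<^sub>v (?Q *\<^sub>v v)))"
      using *[of "T *\<^sub>v (?Q *\<^sub>v v)"] T(1) Qv by simp
    also have "\<dots> = v \<bullet> (G *\<^sub>v v)"
      using P(1) T(1) v Q
      by (simp add: G_def assoc_mult_mat_vec[of _ m n _ m] assoc_mult_mat_vec[of _ m n _ n])
    finally show ?thesis .
  qed
  obtain K where K: "K \<in> carrier_mat m m" "G * K = 1\<^sub>m m"
    using coercive_inverse[OF G symG c' geG] by blast
  \<comment> \<open>Chosen so that \<open>G * \<Lambda> = Y\<close>, which is the constraint for
    \<open>X = T * (transpose_mat P * \<Lambda>)\<close>.\<close>
  define \<Lambda> where "\<Lambda> = K * Y"
  define X where "X = T * (?Q * \<Lambda>)"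
  have L: "\<Lambda> \<in> carrier_mat m k" using K Y by (simp add: \<Lambda>_def)
  have QL: "?Q * \<Lambda> \<in> carrier_mat n k" using Q L by simp
  have X: "X \<in> carrier_mat n k" using T QL by (simp add: X_def)
  have "P * X = (P * T) * (?Q * \<Lambda>)"
    unfolding X_def using P(1) T(1) QL by (rule assoc_mult_mat[symmetric])
  also have "\<dots> = G * \<Lambda>"
    unfolding G_def by (rule assoc_mult_mat[symmetric, of _ m n _ m _ k]) (use P T L in auto)
  also have "\<dots> = (G * K) * Y"
    unfolding \<Lambda>_def using G K(1) Y by (rule assoc_mult_mat[symmetric])
  finally have PX: "P * X = Y" using K Y by simp
  have "S * X = (S * T) * (?Q * \<Lambda>)"
    unfolding X_def using S(1) T(1) QL by (rule assoc_mult_mat[symmetric])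
  then have "S * X = ?Q * \<Lambda>" by (simp only: T(3) left_mult_one_mat[OF QL])
  with that X L PX show thesis by blast
qed

text \<open>The linear term of the expansion around \<open>X\<close> pairs \<open>\<Lambda>\<close>
  with \<open>P * (Z - X)\<close>, which splits into the residual \<open>A\<close> of
  \<open>Z\<close> and the data error \<open>B\<close> at \<open>X\<close>. The part with
  \<open>A\<close> is absorbed by the fidelity term of \<open>Z\<close>; the part with
  \<open>B\<close> costs another multiple of the squared data error.\<close>

lemma tikhonov_estimate:
  fixes S P X Z \<Lambda> Y :: "real mat"
  assumes S: "S \<in> carrier_mat n n" "transpose_mat S = S" and P: "P \<in> carrier_mat m n"
    and X: "X \<in> carrier_mat n k" and Z: "Z \<in> carrier_mat n k"
    and L: "\<Lambda> \<in> carrier_mat m k" and Y: "Y \<in> carrier_mat m k"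
    and SX: "S * X = transpose_mat P * \<Lambda>" and w: "w > 0"
    and le: "1/2 * (frob_norm (P * Z - Y))\<^sup>2 + w * frob_inner Z (S * Z)
      \<le> 1/2 * (frob_norm (P * X - Y))\<^sup>2 + w * frob_inner X (S * X)"
  shows "frob_inner (Z - X) (S * (Z - X))
    \<le> 3/2 * ((frob_norm (Y - P * X))\<^sup>2 / w) + 3 * w * (frob_norm \<Lambda>)\<^sup>2"
proof -
  define E where "E = Z - X"
  define A where "A = P * Z - Y"
  define B where "B = Y - P * X"
  define q where "q = frob_inner E (S * E)"
  have E: "E \<in> carrier_mat n k" unfolding E_def by (rule minus_carrier_mat[OF X])
  have A: "A \<in> carrier_mat m k" and B: "B \<in> carrier_mat m k"
    using P X Z Y by (auto simp: A_def B_def)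
  have PE: "P * E = A + B"
  proof -
    have "P * E = P * Z - P * X" unfolding E_def by (rule mult_minus_distrib_mat[OF P Z X])
    also have "\<dots> = A + B" by (rule eq_matI) (use P X Z Y in \<open>auto simp: A_def B_def\<close>)
    finally show ?thesis .
  qed
  have "frob_inner E (S * X) = frob_inner (A + B) \<Lambda>"
    unfolding SX using frob_inner_mult_left[OF P E L] PE by simp
  then have cross: "frob_inner E (S * X) = frob_inner A \<Lambda> + frob_inner B \<Lambda>"
    using frob_inner_add_left[OF A B L] by simp
  have "Z = X + E" by (rule eq_matI) (use X Z in \<open>auto simp: E_def\<close>)
  then have quad: "frob_inner Z (S * Z) = frob_inner X (S * X)
      + 2 * (frob_inner A \<Lambda> + frob_inner B \<Lambda>) + q"
    using frob_inner_quadratic_add[OF S X E] cross by (simp add: q_def)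
  \<comment> \<open>A sign change, written so that \<open>frob_inner_add_smult_self\<close>
    applies.\<close>
  have PXY: "P * X - Y = 0\<^sub>m m k + (-1) \<cdot>\<^sub>m B"
    by (rule eq_matI) (use P X Y in \<open>auto simp: B_def\<close>)
  have "frob_inner (P * X - Y) (P * X - Y) = frob_inner B B"
    unfolding PXY frob_inner_add_smult_self[OF zero_carrier_mat B]
    using B by (simp add: frob_inner_eq_sum[of _ m k])
  then have B': "(frob_norm (P * X - Y))\<^sup>2 = (frob_norm B)\<^sup>2"
    unfolding frob_norm_def by simp
  \<comment> \<open>Completing squares bounds the two multiplier terms from below.\<close>
  have bA: "0 \<le> (frob_norm A)\<^sup>2 + 4 * w * frob_inner A \<Lambda> + 4 * w\<^sup>2 * (frob_norm \<Lambda>)\<^sup>2"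
    using frob_inner_self_nonneg[of "A + (2 * w) \<cdot>\<^sub>m \<Lambda>" m k] A L
    by (simp add: frob_inner_add_smult_self[OF A L] frob_norm_power2[OF A] frob_norm_power2[OF L]
        power_mult_distrib)
  have bB: "0 \<le> (frob_norm B)\<^sup>2 + 2 * w * frob_inner B \<Lambda> + w\<^sup>2 * (frob_norm \<Lambda>)\<^sup>2"
    using frob_inner_self_nonneg[of "B + w \<cdot>\<^sub>m \<Lambda>" m k] B L
    by (simp add: frob_inner_add_smult_self[OF B L] frob_norm_power2[OF B] frob_norm_power2[OF L])
  have "1/2 * (frob_norm A)\<^sup>2 + 2 * w * frob_inner A \<Lambda> + 2 * w * frob_inner B \<Lambda> + w * q
      \<le> 1/2 * (frob_norm B)\<^sup>2"
    using le unfolding quad B' A_def[symmetric] by (simp add: algebra_simps)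
  \<comment> \<open>Half of \<open>bA\<close> plus \<open>bB\<close>: the factor 3/2 is 1/2 + 1, and
    the factor 3 is 2 + 1.\<close>
  with bA bB have "w * q \<le> 3/2 * (frob_norm B)\<^sup>2 + 3 * w\<^sup>2 * (frob_norm \<Lambda>)\<^sup>2" by simp
  then show ?thesis
    unfolding E_def[symmetric] B_def[symmetric] q_def[symmetric]
    using w by (simp add: field_simps power2_eq_square)
qed

text \<open>A feasible increment lies in the kernel of \<open>P\<close> and is therefore orthogonal
  to \<open>S * X\<close>, which lies in the range of \<open>transpose_mat P\<close>. The expansion
  around \<open>X\<close> loses its linear term, and coercivity of the rest gives the quadratic
  growth \<open>low\<close>, hence both minimality and uniqueness.\<close>

lemma constrained_quadratic_arg_min_iff:
  fixes S P X \<Lambda> :: "real mat"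
  assumes S: "S \<in> carrier_mat n n" "transpose_mat S = S"
    and c: "c > 0" and ge: "\<And>v. v \<in> carrier_vec n \<Longrightarrow> c * (v \<bullet> v) \<le> v \<bullet> (S *\<^sub>v v)"
    and P: "P \<in> carrier_mat m n" and X: "X \<in> carrier_mat n k" and L: "\<Lambda> \<in> carrier_mat m k"
    and SX: "S * X = transpose_mat P * \<Lambda>"
  shows "is_arg_min (\<lambda>Z. frob_inner Z (S * Z)) (\<lambda>Z. Z \<in> carrier_mat n k \<and> P * Z = P * X) Z
    \<longleftrightarrow> Z = X"
proof -
  have low: "frob_inner X (S * X) + c * frob_inner (Z - X) (Z - X) \<le> frob_inner Z (S * Z)"
    if Z: "Z \<in> carrier_mat n k" and PZ: "P * Z = P * X" for Z
  proof -
    define E where "E = Z - X"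
    have E: "E \<in> carrier_mat n k" unfolding E_def by (rule minus_carrier_mat[OF X])
    have "P * E = P * Z - P * X" unfolding E_def by (rule mult_minus_distrib_mat[OF P Z X])
    also have "\<dots> = 0\<^sub>m m k" unfolding PZ by (rule eq_matI) (use P X in auto)
    finally have "frob_inner E (S * X) = 0"
      unfolding SX using frob_inner_mult_left[OF P E L] L
      by (simp add: frob_inner_eq_sum[of _ m k])
    moreover have "Z = X + E" by (rule eq_matI) (use X Z in \<open>auto simp: E_def\<close>)
    ultimately have "frob_inner Z (S * Z) = frob_inner X (S * X) + frob_inner E (S * E)"
      using frob_inner_quadratic_add[OF S X E] by simp
    then show ?thesis using frob_inner_coercive[OF S(1) E ge] by (simp add: E_def)
  qed
  \<comment> \<open>A difference takes its dimensions from the subtrahend, so the carrier of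
    \<open>X\<close> settles the case of any \<open>Z\<close>.\<close>
  have nn: "0 \<le> frob_inner (Z - X) (Z - X)" for Z
    by (rule frob_inner_self_nonneg[OF minus_carrier_mat[OF X]])
  show ?thesis
  proof
    assume Z: "is_arg_min (\<lambda>Z. frob_inner Z (S * Z)) (\<lambda>Z. Z \<in> carrier_mat n k \<and> P * Z = P * X) Z"
    then have Zc: "Z \<in> carrier_mat n k" "P * Z = P * X" by (auto simp: is_arg_min_def)
    have "frob_inner Z (S * Z) \<le> frob_inner X (S * X)"
      using Z X by (force simp: is_arg_min_def)
    with low[OF Zc] have "c * frob_inner (Z - X) (Z - X) \<le> 0" by simp
    with nn[of Z] c have "frob_inner (Z - X) (Z - X) = 0"
      by (simp add: mult_le_0_iff)
    then have 0: "Z - X = 0\<^sub>m n k"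
      by (rule frob_inner_self_eq_0[OF minus_carrier_mat[OF X]])
    show "Z = X"
    proof (rule eq_matI)
      fix i j assume "i < dim_row X" "j < dim_col X"
      then show "Z $$ (i, j) = X $$ (i, j)"
        using arg_cong[OF 0, of "\<lambda>M. M $$ (i, j)"] X Zc by simp
    qed (use X Zc in auto)
  next
    assume "Z = X"
    moreover have "frob_inner X (S * X) \<le> frob_inner Z (S * Z)"
      if "Z \<in> carrier_mat n k" "P * Z = P * X" for Z
      using low[OF that] mult_nonneg_nonneg[OF less_imp_le[OF c] nn[of Z]] by linarith
    ultimately show "is_arg_min (\<lambda>Z. frob_inner Z (S * Z))
        (\<lambda>Z. Z \<in> carrier_mat n k \<and> P * Z = P * X) Z"
      using X by (auto simp: is_arg_min_def not_less)
  qed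
qed

section \<open>The concrete constraint matrix and regularizer\<close>

lemma row_extraction_orthogonal:
  assumes "M \<le> N"
  shows "row_extraction M N \<in> carrier_mat M N"
    "row_extraction M N * transpose_mat (row_extraction M N) = 1\<^sub>m M"
proof -
  show P: "row_extraction M N \<in> carrier_mat M N" by (simp add: row_extraction_def)
  show "row_extraction M N * transpose_mat (row_extraction M N) = 1\<^sub>m M"
  proof (rule eq_matI)
    fix i j assume "i < dim_row (1\<^sub>m M :: real mat)" "j < dim_col (1\<^sub>m M :: real mat)"
    then have ij: "i < M" "j < M" by auto
    then have "(row_extraction M N * transpose_mat (row_extraction M N)) $$ (i, j)
        = (\<Sum>k<N. (if i = k then 1 else 0) * (if j = k then 1 else 0))"
      by (simp add: row_extraction_def scalar_prod_def atLeast0LessThan)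
    also have "\<dots> = (\<Sum>k<N. if i = k then if i = j then 1 else 0 else 0)"
      by (intro sum.cong) auto
    also have "\<dots> = 1\<^sub>m M $$ (i, j)" using ij assms by auto
    finally show "(row_extraction M N * transpose_mat (row_extraction M N)) $$ (i, j)
        = 1\<^sub>m M $$ (i, j)" .
  qed (use P in auto)
qed

text \<open>The shift by \<open>\<tau>\<close> lifts the nonnegative form of the Laplacian to one
  bounded below by \<open>\<tau>\<close>, and the power turns this bound into
  \<open>\<tau> powr \<beta>\<close>.\<close>

lemma regularizer_coercive:
  fixes p :: real
  assumes W: "adjacency_matrix N W" and \<tau>: "\<tau> > 0" and \<beta>: "\<beta> \<ge> 0"
  defines "S \<equiv> mat_powr (graph_laplacian N p W + \<tau> \<cdot>\<^sub>m 1\<^sub>m N) \<beta>"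
  shows "S \<in> carrier_mat N N" "transpose_mat S = S"
    "\<And>v. v \<in> carrier_vec N \<Longrightarrow> \<tau> powr \<beta> * (v \<bullet> v) \<le> v \<bullet> (S *\<^sub>v v)"
proof -
  let ?L = "graph_laplacian N p W"
  note L = graph_laplacian_psd[OF W, where p = p]
  have ge: "\<tau> * (v \<bullet> v) \<le> v \<bullet> ((?L + \<tau> \<cdot>\<^sub>m 1\<^sub>m N) *\<^sub>v v)" if v: "v \<in> carrier_vec N" for v
  proof -
    have "(\<tau> \<cdot>\<^sub>m 1\<^sub>m N) *\<^sub>v v = \<tau> \<cdot>\<^sub>v v"
      using v by (intro eq_vecI) (auto simp: row_smult)
    then have "(?L + \<tau> \<cdot>\<^sub>m 1\<^sub>m N) *\<^sub>v v = ?L *\<^sub>v v + \<tau> \<cdot>\<^sub>v v"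
      using L(1) v by (simp add: add_mult_distrib_mat_vec[of _ N N])
    then show ?thesis
      using L(1) L(3)[OF v] v by (simp add: scalar_prod_add_distrib[of _ N])
  qed
  have "?L + \<tau> \<cdot>\<^sub>m 1\<^sub>m N \<in> carrier_mat N N" using L(1) by simp
  moreover have "transpose_mat (?L + \<tau> \<cdot>\<^sub>m 1\<^sub>m N) = ?L + \<tau> \<cdot>\<^sub>m 1\<^sub>m N"
    using L(1,2) by (simp add: transpose_add[of _ N N]) (auto intro!: eq_matI)
  ultimately show "S \<in> carrier_mat N N" "transpose_mat S = S"
    "\<And>v. v \<in> carrier_vec N \<Longrightarrow> \<tau> powr \<beta> * (v \<bullet> v) \<le> v \<bullet> (S *\<^sub>v v)"
    unfolding S_def using coercive_mat_powr[OF _ _ \<tau> \<beta> ge] by blast+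
qed

theorem theorem4p2:
  fixes N M D :: nat
    and \<tau> \<beta> p :: real
    and W L P \<Phi> :: "real mat"
    and u ubar :: "nat \<Rightarrow> real vec"
    and uhat :: "nat \<Rightarrow> nat \<Rightarrow> real vec"
    and \<Phi>hat \<Phi>star :: "nat \<Rightarrow> real mat"
    and \<omega> \<delta> :: "nat \<Rightarrow> real"
    and \<R> :: "real mat \<Rightarrow> real"
  assumes "1 \<le> M" and "M \<le> N" and "1 \<le> D"
    and "\<tau> > 0" and "\<beta> > 0"
    and "adjacency_matrix N W"
    and "\<forall>i<N. degree_matrix N W $$ (i, i) > 0"
    and u_dim: "\<forall>i<N. u i \<in> carrier_vec D"
    and ubar_dim: "\<forall>i<N. ubar i \<in> carrier_vec D"
    and uhat_dim: "\<forall>n. \<forall>i<M. uhat n i \<in> carrier_vec D"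
    and L_def: "L = graph_laplacian N p W"
    and R_def: "\<R> = regularizer N \<tau> \<beta> L"
    and P_def: "P = row_extraction M N"
    and Phi_def: "\<Phi> = displacement_matrix N D u ubar"
    and Phihat_def: "\<Phi>hat = (\<lambda>n. displacement_matrix M D (uhat n) ubar)"
    and delta_def: "\<delta> = (\<lambda>n. frob_norm (\<Phi>hat n - P * \<Phi>))"
    and omega_pos: "\<forall>n. \<omega> n > 0"
    and Phistar: "\<forall>n. is_arg_min
          (\<lambda>\<Theta>. 1/2 * (frob_norm (P * \<Theta> - \<Phi>hat n))\<^sup>2 + \<omega> n * \<R> \<Theta>)
          (\<lambda>\<Theta>. \<Theta> \<in> carrier_mat N D) (\<Phi>star n)"
    and "decseq \<delta>" and "\<delta> \<longlonglongrightarrow> 0"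
    and "decseq \<omega>" and "\<omega> \<longlonglongrightarrow> 0"
    and "(\<lambda>n. (\<delta> n)\<^sup>2 / \<omega> n) \<longlonglongrightarrow> 0"
  shows "\<exists>\<Phi>inf.
      (\<forall>X. is_arg_min \<R> (\<lambda>\<Theta>. \<Theta> \<in> carrier_mat N D \<and> P * \<Theta> = P * \<Phi>) X \<longleftrightarrow> X = \<Phi>inf) \<and>
      (\<lambda>n. frob_norm (\<Phi>star n - \<Phi>inf)) \<longlonglongrightarrow> 0"
proof -
  define S where "S = mat_powr (graph_laplacian N p W + \<tau> \<cdot>\<^sub>m 1\<^sub>m N) \<beta>"
  define c where "c = \<tau> powr \<beta>"
  have c: "c > 0" using \<open>\<tau> > 0\<close> by (simp add: c_def)
  have S: "S \<in> carrier_mat N N" "transpose_mat S = S"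
    and ge: "\<And>v. v \<in> carrier_vec N \<Longrightarrow> c * (v \<bullet> v) \<le> v \<bullet> (S *\<^sub>v v)"
    using regularizer_coercive[OF \<open>adjacency_matrix N W\<close> \<open>\<tau> > 0\<close>, where \<beta> = \<beta> and p = p] \<open>\<beta> > 0\<close>
    by (auto simp: S_def c_def)
  have R: "\<R> = (\<lambda>\<Theta>. frob_inner \<Theta> (S * \<Theta>))"
    by (simp add: R_def regularizer_def[abs_def] L_def S_def)
  have P: "P \<in> carrier_mat M N" "P * transpose_mat P = 1\<^sub>m M"
    using row_extraction_orthogonal[OF \<open>M \<le> N\<close>] by (auto simp: P_def)
  have \<Phi>: "\<Phi> \<in> carrier_mat N D" and \<Phi>hat: "\<Phi>hat n \<in> carrier_mat M D" for n
    by (auto simp: Phi_def Phihat_def displacement_matrix_def)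
  \<comment> \<open>\<open>X\<close> is the limit; neither it nor \<open>\<Lambda>\<close> depends
    on \<open>n\<close>, so the estimate below has fixed constants.\<close>
  obtain X \<Lambda> where X: "X \<in> carrier_mat N D" and \<Lambda>: "\<Lambda> \<in> carrier_mat M D"
    and PX: "P * X = P * \<Phi>" and SX: "S * X = transpose_mat P * \<Lambda>"
    using constrained_minimizer_multiplier_exists[OF S c ge P mult_carrier_mat[OF P(1) \<Phi>]] by blast
  have "is_arg_min \<R> (\<lambda>\<Theta>. \<Theta> \<in> carrier_mat N D \<and> P * \<Theta> = P * \<Phi>) Z \<longleftrightarrow> Z = X" for Z
    unfolding R PX[symmetric]
    by (rule constrained_quadratic_arg_min_iff[OF S c ge P(1) X \<Lambda> SX])
  moreover have "(\<lambda>n. frob_norm (\<Phi>star n - X)) \<longlonglongrightarrow> 0"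
  proof -
    \<comment> \<open>The right-hand side of \<open>tikhonov_estimate\<close>, with data error
      \<open>\<delta> n\<close> since \<open>P * X = P * \<Phi>\<close>, divided by the coercivity
      constant to pass from the regularizer to the squared Frobenius norm.\<close>
    define b where "b n = (3/2 * ((\<delta> n)\<^sup>2 / \<omega> n) + 3 * \<omega> n * (frob_norm \<Lambda>)\<^sup>2) / c" for n
    have star: "\<Phi>star n \<in> carrier_mat N D" for n
      using Phistar by (auto simp: is_arg_min_def)
    have bound: "frob_inner (\<Phi>star n - X) (\<Phi>star n - X) \<le> b n" for n
    proof -
      have "c * frob_inner (\<Phi>star n - X) (\<Phi>star n - X)
          \<le> frob_inner (\<Phi>star n - X) (S * (\<Phi>star n - X))"
        by (rule frob_inner_coercive[OF S(1) minus_carrier_mat[OF X] ge])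
      also have "\<dots> \<le> 3/2 * ((frob_norm (\<Phi>hat n - P * X))\<^sup>2 / \<omega> n) + 3 * \<omega> n * (frob_norm \<Lambda>)\<^sup>2"
      proof (rule tikhonov_estimate[OF S P(1) X star \<Lambda> \<Phi>hat SX])
        show "1/2 * (frob_norm (P * \<Phi>star n - \<Phi>hat n))\<^sup>2
            + \<omega> n * frob_inner (\<Phi>star n) (S * \<Phi>star n)
          \<le> 1/2 * (frob_norm (P * X - \<Phi>hat n))\<^sup>2 + \<omega> n * frob_inner X (S * X)"
          \<comment> \<open>Minimality of \<open>\<Phi>star n\<close> is tested against the fixed
            competitor \<open>X\<close>.\<close>
          using spec[OF Phistar, of n] X unfolding R is_arg_min_def not_less[symmetric] by blast
      qed (use omega_pos in auto)
      finally show ?thesis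
        using c unfolding b_def delta_def PX by (simp add: pos_le_divide_eq mult.commute)
    qed
    \<comment> \<open>The first term vanishes by the limit of
      \<open>(\<delta> n)\<^sup>2 / \<omega> n\<close>, the second by that of
      \<open>\<omega>\<close>.\<close>
    have "b \<longlonglongrightarrow> (3/2 * 0 + 3 * 0 * (frob_norm \<Lambda>)\<^sup>2) / c"
      unfolding b_def by (intro tendsto_intros assms) (use c in simp)
    then have "b \<longlonglongrightarrow> 0" by simp
    have "(\<lambda>n. frob_inner (\<Phi>star n - X) (\<Phi>star n - X)) \<longlonglongrightarrow> 0"
      by (rule tendsto_sandwich[OF _ _ tendsto_const \<open>b \<longlonglongrightarrow> 0\<close>])
        (use bound frob_inner_self_nonneg[OF minus_carrier_mat[OF X]] in auto)
    then show ?thesis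
      unfolding frob_norm_def using tendsto_real_sqrt by fastforce
  qed
  ultimately show ?thesis by blast
qed

end
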